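(* Let $G$ be a connected graph on $n\ge 2$ vertices with Laplacian matrix $L$, whose distinct eigenvalues are $0=\lambda_0<\lambda_1<\cdots<\lambda_d$, and let $k$ and $m_i$ ($i=1,\ldots,k$) be positive integers such that $\sum_{i=1}^k m_i=n$. Then the optimal value of the semidefinite program $$\min\ \tfrac12\operatorname{tr}LY\quad\text{s.t.}\quad \operatorname{tr}Y=n,\ \ \operatorname{tr}J_nY=\sum_{i=1}^k m_i^2,\ \ kY-J_n\succeq 0$$ (over real symmetric $n\times n$ matrices $Y$), which is a lower bound for the minimum graph partition problem of $G$, is equal to $$\frac{\lambda_1}{n}\sum_{i<j}m_im_j,$$ and the optimal value of the program obtained by replacing $\min$ by $\max$, which is an upper bound for the maximum graph partition problem of $G$, is equal to $$\frac{\lambda_d}{n}\sum_{i<j}m_im_j.$$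
   Context: Graphs are undirected. If $A$ is the adjacency matrix of $G$ and $u_n$ is the all-ones vector, the Laplacian matrix is $L=\operatorname{Diag}(Au_n)-A$, where $\operatorname{Diag}(x)$ is the diagonal matrix with diagonal $x$. $J_n$ is the $n\times n$ all-ones matrix. The minimum (resp. maximum) graph partition problem asks for a partition of the vertex set into $k$ disjoint sets of sizes $m_1,\dots,m_k$ such that the sum of weights of edges joining different sets is minimized (resp. maximized). *)

theory Defs
  imports "HOL-Analysis.Analysis"
begin

text \<open>
  A graph on the vertex type \<open>'n\<close> is given by its set of edges, which are two-element sets of
  vertices. Edges carry weights \<open>w\<close>; an unweighted graph is the case \<open>w = (\<lambda>_. 1)\<close>.
\<close>

definition simple_graph :: "'n set set \<Rightarrow> bool" where
  "simple_graph E \<longleftrightarrow> (\<forall>e\<in>E. card e = 2)"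

definition connected_graph :: "'n set set \<Rightarrow> bool" where
  "connected_graph E \<longleftrightarrow> (\<forall>u v. (u, v) \<in> {(x, y). {x, y} \<in> E}\<^sup>*)"

definition adjacency :: "'n set set \<Rightarrow> ('n set \<Rightarrow> real) \<Rightarrow> real^'n^'n" where
  "adjacency E w = (\<chi> i j. if {i, j} \<in> E then w {i, j} else 0)"

definition Diag :: "real^'n \<Rightarrow> real^'n^'n" where
  "Diag x = (\<chi> i j. if i = j then x $ i else 0)"

definition all_ones_vec :: "real^'n" where
  "all_ones_vec = (\<chi> i. 1)"

definition all_ones_mat :: "real^'n^'n" where
  "all_ones_mat = (\<chi> i j. 1)"

definition laplacian :: "'n::finite set set \<Rightarrow> ('n set \<Rightarrow> real) \<Rightarrow> real^'n^'n" where
  "laplacian E w = Diag (adjacency E w *v all_ones_vec) - adjacency E w"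

definition eigenvalues :: "real^'n::finite^'n \<Rightarrow> real set" where
  "eigenvalues M = {c. \<exists>x. x \<noteq> 0 \<and> M *v x = c *\<^sub>R x}"

definition symmetric_mat :: "real^'n^'n \<Rightarrow> bool" where
  "symmetric_mat M \<longleftrightarrow> transpose M = M"

definition psd :: "real^'n::finite^'n \<Rightarrow> bool" where
  "psd M \<longleftrightarrow> symmetric_mat M \<and> (\<forall>x. 0 \<le> x \<bullet> (M *v x))"

text \<open>Optimal values of \<open>min {f x | x \<in> F}\<close> and \<open>max {f x | x \<in> F}\<close>; the optimum has to be attained.\<close>

definition optimal_value_min :: "('a \<Rightarrow> real) \<Rightarrow> 'a set \<Rightarrow> real \<Rightarrow> bool" where
  "optimal_value_min f F v \<longleftrightarrow> (\<exists>x\<in>F. f x = v) \<and> (\<forall>x\<in>F. v \<le> f x)"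

definition optimal_value_max :: "('a \<Rightarrow> real) \<Rightarrow> 'a set \<Rightarrow> real \<Rightarrow> bool" where
  "optimal_value_max f F v \<longleftrightarrow> (\<exists>x\<in>F. f x = v) \<and> (\<forall>x\<in>F. f x \<le> v)"

definition sdp_feasible :: "nat \<Rightarrow> (nat \<Rightarrow> nat) \<Rightarrow> (real^'n::finite^'n) set" where
  "sdp_feasible k m = {Y. symmetric_mat Y
     \<and> trace Y = real CARD('n)
     \<and> trace (all_ones_mat ** Y) = (\<Sum>i=1..k. (real (m i))\<^sup>2)
     \<and> psd (real k *\<^sub>R Y - all_ones_mat)}"

definition sdp_objective :: "real^'n::finite^'n \<Rightarrow> real^'n^'n \<Rightarrow> real" where
  "sdp_objective L Y = 1 / 2 * trace (L ** Y)"

definition vertex_partitions :: "nat \<Rightarrow> (nat \<Rightarrow> nat) \<Rightarrow> (nat \<Rightarrow> 'n set) set" where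
  "vertex_partitions k m = {S. disjoint_family_on S {1..k}
     \<and> (\<Union>i\<in>{1..k}. S i) = UNIV
     \<and> (\<forall>i\<in>{1..k}. card (S i) = m i)}"

definition cut_edges :: "'n set set \<Rightarrow> nat \<Rightarrow> (nat \<Rightarrow> 'n set) \<Rightarrow> 'n set set" where
  "cut_edges E k S =
     {e\<in>E. \<exists>i\<in>{1..k}. \<exists>j\<in>{1..k}. i \<noteq> j \<and> (\<exists>u\<in>S i. \<exists>v\<in>S j. e = {u, v})}"

definition cut_weight :: "'n set set \<Rightarrow> ('n set \<Rightarrow> real) \<Rightarrow> nat \<Rightarrow> (nat \<Rightarrow> 'n set) \<Rightarrow> real" where
  "cut_weight E w k S = (\<Sum>e\<in>cut_edges E k S. w e)"

text \<open>
  \<open>Min\<close> and \<open>Max\<close> are taken over finite sets, as the vertex type is finite; the sets are nonempty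
  whenever the prescribed sizes add up to the number of vertices.
\<close>

definition min_graph_partition ::
    "'n::finite set set \<Rightarrow> ('n set \<Rightarrow> real) \<Rightarrow> nat \<Rightarrow> (nat \<Rightarrow> nat) \<Rightarrow> real" where
  "min_graph_partition E w k m = Min (cut_weight E w k ` vertex_partitions k m)"

definition max_graph_partition ::
    "'n::finite set set \<Rightarrow> ('n set \<Rightarrow> real) \<Rightarrow> nat \<Rightarrow> (nat \<Rightarrow> nat) \<Rightarrow> real" where
  "max_graph_partition E w k m = Max (cut_weight E w k ` vertex_partitions k m)"

lemma adjacency_unweighted:
  "adjacency E (\<lambda>_. 1) $ i $ j = (if {i, j} \<in> E then 1 else 0)"
  by (simp add: adjacency_def)

lemma cut_weight_unweighted:
  "cut_weight E (\<lambda>_. 1) k S = real (card (cut_edges E k S))"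
  by (simp add: cut_weight_def)

end

theory Submission
  imports Defs
begin

text \<open>On the orthogonal complement of the all-ones vector \<open>u\<close>, the quadratic form of \<open>L\<close> lies
  between \<open>\<lambda>\<^sub>1 \<bar>x\<bar>\<^sup>2\<close> and \<open>\<lambda>\<^sub>d \<bar>x\<bar>\<^sup>2\<close>, that is,
  \<open>\<lambda>\<^sub>1 (I - J/n) \<preceq> L \<preceq> \<lambda>\<^sub>d (I - J/n)\<close>. Taking the trace against the positive semidefinite
  matrix \<open>kY - J\<close>, whose traces against \<open>I\<close> and \<open>J\<close> are fixed by the constraints, bounds the
  objective on both sides. With \<open>s = \<Sum> m\<^sub>i\<^sup>2\<close> and a unit eigenvector \<open>v\<close> of \<open>\<lambda>\<^sub>1\<close> or \<open>\<lambda>\<^sub>d\<close>, the bounds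
  are attained at \<open>(s/n\<^sup>2) J + (n - s/n) v v\<^sup>T\<close>; feasibility is \<open>n\<^sup>2/k \<le> s \<le> n\<^sup>2\<close>. A partition gives the
  feasible matrix \<open>Y\<close> with \<open>Y\<^sub>u\<^sub>v = 1\<close> if \<open>u\<close> and \<open>v\<close> share a block and \<open>0\<close> otherwise, whose objective
  value is the weight of the cut.\<close>

section \<open>Rayleigh quotients of symmetric operators\<close>

lemma symmetric_mat_inner:
  assumes "symmetric_mat M"
  shows "x \<bullet> (M *v y) = (M *v x) \<bullet> y"
  using assms by (metis dot_lmul_matrix symmetric_mat_def transpose_matrix_vector)

text \<open>The polynomial in \<open>key\<close> is nonnegative for every real \<open>t\<close>, so
  its discriminant is not positive. Restricting to a subspace matters for the Rayleigh argument,
  where the form is known to be semidefinite on \<open>T\<close>.\<close>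

lemma form_Cauchy_Schwarz:
  fixes f :: "'a::real_inner \<Rightarrow> 'a"
  assumes lin: "linear f" and T: "subspace T"
    and sym: "\<And>x y. x \<bullet> f y = f x \<bullet> y"
    and nonneg: "\<And>x. x \<in> T \<Longrightarrow> 0 \<le> x \<bullet> f x"
    and "x \<in> T" "y \<in> T"
  shows "(x \<bullet> f y)\<^sup>2 \<le> (x \<bullet> f x) * (y \<bullet> f y)"
proof -
  define a b c where "a = x \<bullet> f x" and "b = x \<bullet> f y" and "c = y \<bullet> f y"
  have key: "0 \<le> a + 2 * t * b + t\<^sup>2 * c" for t
  proof -
    have "0 \<le> (x + t *\<^sub>R y) \<bullet> f (x + t *\<^sub>R y)"
      using T assms by (intro nonneg subspace_add subspace_scale)
    also have "\<dots> = a + 2 * t * b + t\<^sup>2 * c"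
      using sym[of y x]
      by (simp add: linear_add[OF lin] linear_scale[OF lin] inner_simps a_def b_def c_def
          power2_eq_square inner_commute algebra_simps)
    finally show ?thesis .
  qed
  have "b\<^sup>2 \<le> a * c"
  proof (cases "c = 0")
    case True
    have "b = 0"
    proof (rule ccontr)
      assume "b \<noteq> 0"
      \<comment> \<open>With \<open>c = 0\<close> the polynomial is affine in \<open>t\<close>, and
        at this \<open>t\<close> it equals -1.\<close>
      with key[of "- (a + 1) / (2 * b)"] True show False by (simp add: field_simps)
    qed
    then show ?thesis using True by simp
  next
    case False
    then have "c > 0" using nonneg \<open>y \<in> T\<close> by (simp add: c_def less_le)
    \<comment> \<open>This \<open>t\<close> minimises the quadratic; its value there is
      \<open>a - b\<^sup>2 / c\<close>.\<close>
    with key[of "- b / c"] show ?thesis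
      by (simp add: field_simps power2_eq_square)
  qed
  then show ?thesis by (simp add: a_def b_def c_def)
qed

text \<open>Compactness of the unit sphere of \<open>T\<close>, nonempty because of
  \<open>z\<close>, gives a minimiser \<open>v\<close> of the form. With \<open>c\<close> the
  minimum, the form of \<open>f - c\<close> is semidefinite on \<open>T\<close> and vanishes at
  \<open>v\<close>; Cauchy-Schwarz then makes \<open>v\<close> an eigenvector.\<close>

lemma Rayleigh_minimum_on_invariant_subspace:
  fixes f :: "'a::euclidean_space \<Rightarrow> 'a"
  assumes lin: "linear f" and sym: "\<And>x y. x \<bullet> f y = f x \<bullet> y"
    and T: "subspace T" and inv: "\<And>x. x \<in> T \<Longrightarrow> f x \<in> T"
    and "z \<in> T" "z \<noteq> 0"
  obtains v c where "v \<in> T" "v \<noteq> 0" "f v = c *\<^sub>R v" "\<And>x. x \<in> T \<Longrightarrow> c * (x \<bullet> x) \<le> x \<bullet> f x"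
proof -
  define K where "K = T \<inter> sphere 0 1"
  have "compact K"
    unfolding K_def by (intro closed_Int_compact closed_subspace T compact_sphere)
  moreover have "z /\<^sub>R norm z \<in> K"
    using assms by (simp add: K_def subspace_scale)
  moreover have "continuous_on K (\<lambda>x. x \<bullet> f x)"
    using lin by (intro continuous_intros linear_continuous_on) (simp add: linear_linear)
  ultimately obtain v where v: "v \<in> K" and min: "\<And>x. x \<in> K \<Longrightarrow> v \<bullet> f v \<le> x \<bullet> f x"
    using continuous_attains_inf[of K "\<lambda>x. x \<bullet> f x"] by blast
  define c where "c = v \<bullet> f v"
  have vT: "v \<in> T" and vn: "v \<bullet> v = 1"
    using v by (auto simp: K_def norm_eq_1)
  have bound: "c * (x \<bullet> x) \<le> x \<bullet> f x" if "x \<in> T" for x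
  proof (cases "x = 0")
    case True
    then show ?thesis by simp
  next
    case False
    then have "x /\<^sub>R norm x \<in> K"
      using that T by (simp add: K_def subspace_scale)
    from min[OF this] have "c \<le> (x \<bullet> f x) / (norm x)\<^sup>2"
      by (simp add: c_def linear_scale[OF lin] power2_eq_square divide_inverse mult_ac)
    then show ?thesis
      using False by (simp add: field_simps dot_square_norm)
  qed
  define g where "g x = f x - c *\<^sub>R x" for x
  have "linear g"
    unfolding g_def
    by (intro linear_compose_sub lin linear_scale_self)
  moreover have "x \<bullet> g y = g x \<bullet> y" for x y
    by (simp add: g_def inner_simps sym)
  moreover have "0 \<le> x \<bullet> g x" if "x \<in> T" for x
    using bound[OF that] by (simp add: g_def inner_simps)
  moreover have gT: "g v \<in> T"
    unfolding g_def using vT T inv by (intro subspace_diff subspace_scale) auto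
  \<comment> \<open>Pairing \<open>v\<close> with \<open>g v\<close> makes the left side the fourth
    power of the norm of \<open>g v\<close>; invariance of \<open>T\<close> is what puts
    \<open>g v\<close> in \<open>T\<close>.\<close>
  ultimately have "(g v \<bullet> g v)\<^sup>2 \<le> (g v \<bullet> g (g v)) * (v \<bullet> g v)"
    using form_Cauchy_Schwarz[of g T "g v" v] T vT by blast
  also have "v \<bullet> g v = 0"
    by (simp add: g_def inner_simps c_def vn)
  finally have "g v = 0" by simp
  then have "f v = c *\<^sub>R v" by (simp add: g_def)
  with that vT vn bound show thesis by (metis inner_zero_left zero_neq_one)
qed

section \<open>Rank-one matrices and trace identities\<close>

text \<open>The rank-one matrix of \<open>v\<close> times its transpose. The matrix
  \<open>J\<close>, the optimal solutions and the partition matrices are all built from such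
  terms.\<close>

definition outer :: "real^'n \<Rightarrow> real^'n^'n" where
  "outer v = (\<chi> i j. v $ i * v $ j)"

lemma outer_mult_vec: "outer v *v x = (v \<bullet> x) *\<^sub>R v"
  by (simp add: vec_eq_iff outer_def matrix_vector_mult_def inner_vec_def sum_distrib_left mult_ac)

lemma symmetric_mat_outer: "symmetric_mat (outer v)"
  by (simp add: symmetric_mat_def outer_def transpose_def vec_eq_iff mult.commute)

lemma trace_mult: "trace (A ** B) = (\<Sum>i\<in>UNIV. \<Sum>j\<in>UNIV. A $ i $ j * B $ j $ i)"
  by (simp add: trace_def matrix_matrix_mult_def)

lemma trace_mult_outer: "trace (A ** outer v) = v \<bullet> (A *v v)"
  by (simp add: trace_mult outer_def inner_vec_def matrix_vector_mult_def sum_distrib_left mult_ac)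

lemma trace_scaleR: "trace (c *\<^sub>R A) = c * trace (A :: real^'n^'n)"
  by (simp add: trace_def sum_distrib_left)

lemma matrix_mult_scaleR_right: "A ** (c *\<^sub>R B) = c *\<^sub>R (A ** (B :: real^'n^'m))"
  by (simp add: vec_eq_iff matrix_matrix_mult_def sum_distrib_left mult_ac)

lemma matrix_mult_scaleR_left: "(c *\<^sub>R A) ** B = c *\<^sub>R (A ** (B :: real^'n^'m))"
  by (simp add: vec_eq_iff matrix_matrix_mult_def sum_distrib_left mult_ac)

lemma matrix_sub_ldistrib: "A ** (B - C) = A ** B - A ** (C :: real^'n^'m)"
  by (simp add: vec_eq_iff matrix_matrix_mult_def right_diff_distrib sum_subtractf)

lemma matrix_sub_rdistrib: "(B - C) ** A = B ** A - C ** (A :: real^'n^'m)"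
  by (simp add: vec_eq_iff matrix_matrix_mult_def left_diff_distrib sum_subtractf)

lemma matrix_vector_mult_sum_rdistrib: "(\<Sum>i\<in>I. A i) *v x = (\<Sum>i\<in>I. (A i :: real^'n^'m) *v x)"
  by (induction I rule: infinite_finite_induct) (simp_all add: matrix_vector_mult_add_rdistrib)

lemma matrix_vector_mult_minus_left: "(- A) *v x = - ((A :: real^'n^'m) *v x)"
  by (simp add: vec_eq_iff matrix_vector_mult_def sum_negf)

lemma all_ones_mat_eq_outer: "all_ones_mat = outer all_ones_vec"
  by (simp add: all_ones_mat_def all_ones_vec_def outer_def)

lemma all_ones_vec_inner: "all_ones_vec \<bullet> x = (\<Sum>i\<in>UNIV. x $ i)"
  by (simp add: all_ones_vec_def inner_vec_def)

lemma all_ones_vec_inner_self: "(all_ones_vec :: real^'n::finite) \<bullet> all_ones_vec = real CARD('n)"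
  by (simp add: all_ones_vec_def inner_vec_def)

lemma symmetric_mat_diff: "symmetric_mat A \<Longrightarrow> symmetric_mat B \<Longrightarrow> symmetric_mat (A - B)"
  by (simp add: symmetric_mat_def transpose_def vec_eq_iff)

lemma symmetric_mat_add: "symmetric_mat A \<Longrightarrow> symmetric_mat B \<Longrightarrow> symmetric_mat (A + B)"
  by (simp add: symmetric_mat_def transpose_def vec_eq_iff)

lemma symmetric_mat_scaleR: "symmetric_mat A \<Longrightarrow> symmetric_mat (c *\<^sub>R A)"
  by (simp add: symmetric_mat_def transpose_def vec_eq_iff)

section \<open>Traces against positive semidefinite matrices\<close>

lemma psd_Cauchy_Schwarz:
  assumes "psd Z"
  shows "(x \<bullet> (Z *v y))\<^sup>2 \<le> (x \<bullet> (Z *v x)) * (y \<bullet> (Z *v y))"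
  using assms unfolding psd_def
  by (intro form_Cauchy_Schwarz[of "(*v) Z" UNIV])
    (auto intro: matrix_vector_mul_linear symmetric_mat_inner)

text \<open>Peeling off one Schur complement at a time avoids the spectral decomposition of \<open>Z\<close>. A zero
  pivot needs no case distinction: its column vanishes by Cauchy-Schwarz, and \<open>1 / 0 = 0\<close>.\<close>

lemma trace_mult_nonneg:
  fixes M Z :: "real^'n::finite^'n"
  assumes M: "\<And>x. 0 \<le> x \<bullet> (M *v x)" and Z: "psd Z"
  shows "0 \<le> trace (M ** Z)"
proof -
  \<comment> \<open>Induction on a set \<open>S\<close> of indices outside which the rows of
    \<open>Z\<close> vanish; one Schur complement clears row \<open>p\<close>.\<close>
  have "0 \<le> trace (M ** Z)"
    if "finite S" "psd Z" "\<And>i j. i \<notin> S \<Longrightarrow> Z $ i $ j = 0" for S and Z :: "real^'n^'n"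
    using that
  proof (induction S arbitrary: Z rule: finite_induct)
    case empty
    then have "Z = 0" by (simp add: vec_eq_iff)
    then show ?case by (simp add: trace_def)
  next
    case (insert p S)
    define v where "v = Z *v axis p 1"
    have v_nth: "v $ i = Z $ i $ p" for i
      by (simp add: v_def matrix_vector_mult_basis column_def)
    have sym: "Z $ i $ j = Z $ j $ i" for i j
      using insert.prems(1) unfolding psd_def symmetric_mat_def transpose_def
      by (metis vec_lambda_beta)
    define q where "q = Z $ p $ p"
    have q: "axis p 1 \<bullet> v = q" by (simp add: inner_axis' v_nth q_def)
    have CS: "(x \<bullet> v)\<^sup>2 \<le> (x \<bullet> (Z *v x)) * q" for x
      using psd_Cauchy_Schwarz[OF insert.prems(1), of x "axis p 1"] by (simp add: q v_def[symmetric])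
    have q0: "0 \<le> q" using insert.prems(1) q unfolding psd_def v_def by metis
    define Z' where "Z' = Z - (1 / q) *\<^sub>R outer v"
    have "psd Z'"
      unfolding psd_def
    proof (intro conjI allI)
      show "symmetric_mat Z'"
        using insert.prems(1) unfolding Z'_def psd_def
        by (intro symmetric_mat_diff symmetric_mat_scaleR symmetric_mat_outer) auto
      fix x
      have "x \<bullet> (Z' *v x) = x \<bullet> (Z *v x) - (x \<bullet> v)\<^sup>2 / q"
        by (simp add: Z'_def matrix_vector_mult_diff_rdistrib scaleR_matrix_vector_assoc[symmetric]
            outer_mult_vec inner_simps inner_commute power2_eq_square)
      moreover have "(x \<bullet> v)\<^sup>2 / q \<le> x \<bullet> (Z *v x)"
        using CS[of x] q0 insert.prems(1)
        by (cases "q = 0") (auto simp: psd_def divide_le_eq)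
      ultimately show "0 \<le> x \<bullet> (Z' *v x)" by simp
    qed
    moreover have "Z' $ i $ j = 0" if "i \<notin> S" for i j
    proof (cases "i = p")
      case True
      show ?thesis
      proof (cases "q = 0")
        case True
        then have "axis j 1 \<bullet> v = 0" using CS[of "axis j 1"] by simp
        then have "Z $ j $ p = 0" by (simp add: inner_axis' v_nth)
        then show ?thesis using sym \<open>i = p\<close> \<open>q = 0\<close> by (simp add: Z'_def)
      next
        case False
        then show ?thesis using sym[of p j] \<open>i = p\<close>
          by (simp add: Z'_def outer_def v_nth q_def)
      qed
    next
      case False
      with that insert.prems(2) show ?thesis by (simp add: Z'_def outer_def v_nth)
    qed
    ultimately have "0 \<le> trace (M ** Z')" by (rule insert.IH)
    moreover have "trace (M ** Z) = trace (M ** Z') + (1 / q) * (v \<bullet> (M *v v))"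
      by (simp add: Z'_def matrix_sub_ldistrib trace_sub matrix_mult_scaleR_right trace_scaleR
          trace_mult_outer)
    ultimately show ?case using M[of v] q0 by simp
  qed
  from this[of UNIV Z] Z show ?thesis by simp
qed

text \<open>The matrix \<open>L - c (I - J/n)\<close> annihilates the all-ones vector and is
  nonnegative on its orthogonal complement by \<open>bound\<close>, so its quadratic form is
  nonnegative everywhere.\<close>

lemma trace_mult_ge_of_centered_bound:
  fixes L Z :: "real^'n::finite^'n"
  assumes sym: "symmetric_mat L" and L1: "L *v all_ones_vec = 0"
    and bound: "\<And>x. all_ones_vec \<bullet> x = 0 \<Longrightarrow> c * (x \<bullet> x) \<le> x \<bullet> (L *v x)"
    and Z: "psd Z"
  shows "c * (trace Z - trace (all_ones_mat ** Z) / real CARD('n)) \<le> trace (L ** Z)"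
proof -
  let ?n = "real CARD('n)" and ?u = "all_ones_vec :: real^'n"
  define M where "M = L - (c *\<^sub>R mat 1 - (c / ?n) *\<^sub>R all_ones_mat)"
  have "0 \<le> x \<bullet> (M *v x)" for x
  proof -
    \<comment> \<open>\<open>t\<close> times the all-ones vector is the orthogonal projection of
      \<open>x\<close> onto that direction, and \<open>y\<close> is the centered remainder.\<close>
    define t where "t = (?u \<bullet> x) / ?n"
    define y where "y = x - t *\<^sub>R ?u"
    have uy: "?u \<bullet> y = 0"
      by (simp add: y_def t_def inner_simps all_ones_vec_inner_self)
    have x: "x = y + t *\<^sub>R ?u" by (simp add: y_def)
    have "L *v x = L *v y"
      by (simp add: x matrix_vector_right_distrib matrix_vector_mult_scaleR L1)
    moreover have "?u \<bullet> (L *v y) = 0"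
      by (simp add: symmetric_mat_inner[OF sym] L1)
    ultimately have "x \<bullet> (L *v x) = y \<bullet> (L *v y)"
      by (simp add: x inner_simps)
    moreover have "x \<bullet> (M *v x) = x \<bullet> (L *v x) - c * (x \<bullet> x) + c / ?n * (?u \<bullet> x)\<^sup>2"
      by (simp add: M_def matrix_vector_mult_diff_rdistrib scaleR_matrix_vector_assoc[symmetric]
          all_ones_mat_eq_outer outer_mult_vec inner_simps inner_commute power2_eq_square)
    moreover have "x \<bullet> x = y \<bullet> y + t\<^sup>2 * ?n"
      using uy by (simp add: x inner_simps inner_commute all_ones_vec_inner_self power2_eq_square)
    moreover have "(?u \<bullet> x)\<^sup>2 = t\<^sup>2 * ?n\<^sup>2" by (simp add: t_def power_divide)
    \<comment> \<open>The last bracket is the contribution of the all-ones component and cancels to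
      zero.\<close>
    ultimately have "x \<bullet> (M *v x) = y \<bullet> (L *v y) - c * (y \<bullet> y) + (c / ?n * (t\<^sup>2 * ?n\<^sup>2) - c * (t\<^sup>2 * ?n))"
      by (simp only: ring_distribs)
    then have "x \<bullet> (M *v x) = y \<bullet> (L *v y) - c * (y \<bullet> y)"
      by (simp add: power2_eq_square)
    with bound[OF uy] show ?thesis by simp
  qed
  from trace_mult_nonneg[OF this Z]
  show ?thesis
    by (simp add: M_def matrix_sub_rdistrib trace_sub matrix_mult_scaleR_left trace_scaleR
        right_diff_distrib)
qed

section \<open>The Laplacian and its spectrum on centered vectors\<close>

lemma symmetric_mat_laplacian: "symmetric_mat (laplacian E w)"
  by (simp add: symmetric_mat_def laplacian_def transpose_def vec_eq_iff Diag_def adjacency_def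
      insert_commute)

lemma laplacian_mult_vec_nth:
  "(laplacian E w *v x) $ i = (\<Sum>j\<in>UNIV. adjacency E w $ i $ j * (x $ i - x $ j))"
proof -
  have "(laplacian E w *v x) $ i =
      (\<Sum>j\<in>UNIV. (if i = j then (\<Sum>l\<in>UNIV. adjacency E w $ i $ l) * x $ i else 0)
        - adjacency E w $ i $ j * x $ j)"
    by (auto simp: laplacian_def Diag_def matrix_vector_mult_def all_ones_vec_def algebra_simps
        intro!: sum.cong)
  then show ?thesis
    by (simp add: sum_subtractf sum_distrib_right right_diff_distrib)
qed

lemma laplacian_all_ones_vec: "laplacian E w *v all_ones_vec = 0"
  by (simp add: vec_eq_iff laplacian_mult_vec_nth all_ones_vec_def)

text \<open>Swapping the summation indices gives a second expression for the form; adding both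
  completes the squares. The factor 2 reflects summation over ordered pairs.\<close>

lemma laplacian_quadratic_form:
  "2 * (x \<bullet> (laplacian E w *v x)) =
    (\<Sum>i\<in>UNIV. \<Sum>j\<in>UNIV. adjacency E w $ i $ j * (x $ i - x $ j)\<^sup>2)"
proof -
  let ?A = "\<lambda>i j. adjacency E w $ i $ j"
  have sym: "?A i j = ?A j i" for i j by (simp add: adjacency_def insert_commute)
  have 1: "x \<bullet> (laplacian E w *v x) = (\<Sum>i\<in>UNIV. \<Sum>j\<in>UNIV. ?A i j * (x $ i - x $ j) * x $ i)"
    by (simp add: inner_vec_def laplacian_mult_vec_nth sum_distrib_left mult_ac)
  also have "\<dots> = (\<Sum>i\<in>UNIV. \<Sum>j\<in>UNIV. ?A j i * (x $ j - x $ i) * x $ j)"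
    by (rule sum.swap)
  finally have 2: "x \<bullet> (laplacian E w *v x)
      = (\<Sum>i\<in>UNIV. \<Sum>j\<in>UNIV. ?A i j * (x $ j - x $ i) * x $ j)"
    by (simp add: sym)
  have "2 * (x \<bullet> (laplacian E w *v x)) = (\<Sum>i\<in>UNIV. \<Sum>j\<in>UNIV.
      ?A i j * (x $ i - x $ j) * x $ i + ?A i j * (x $ j - x $ i) * x $ j)"
    unfolding sum.distrib 1[symmetric] 2[symmetric] by simp
  then show ?thesis by (simp add: algebra_simps power2_eq_square)
qed

text \<open>A kernel vector makes the sum of squares zero, so positive weights force equal entries
  at the two ends of each edge; connectivity spreads the equality to all vertices.\<close>

lemma laplacian_kernel_constant:
  fixes E :: "'n::finite set set"
  assumes "connected_graph E" and w: "\<And>e. e \<in> E \<Longrightarrow> w e > 0" and "laplacian E w *v x = 0"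
  shows "x $ i = x $ j"
proof -
  have nonneg: "0 \<le> adjacency E w $ i $ j * (x $ i - x $ j)\<^sup>2" for i j
    using w by (auto simp: adjacency_def less_imp_le)
  have "(\<Sum>i\<in>UNIV. \<Sum>j\<in>UNIV. adjacency E w $ i $ j * (x $ i - x $ j)\<^sup>2) = 0"
    using laplacian_quadratic_form[of x E w] assms(3) by simp
  then have zero: "adjacency E w $ i $ j * (x $ i - x $ j)\<^sup>2 = 0" for i j
    using nonneg by (simp add: sum_nonneg_eq_0_iff sum_nonneg)
  have step: "x $ a = x $ b" if "{a, b} \<in> E" for a b
    using zero[of a b] w[OF that] that by (auto simp: adjacency_def)
  have "(i, j) \<in> {(x, y). {x, y} \<in> E}\<^sup>*"
    using assms(1) by (simp add: connected_graph_def)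
  then show ?thesis by (induction rule: rtrancl_induct) (auto simp: step)
qed

text \<open>An eigenvector for 0 would be constant, and a constant vector with entry sum 0
  vanishes.\<close>

lemma centered_eigenvector_eigenvalue_nonzero:
  fixes E :: "'n::finite set set"
  assumes "connected_graph E" "\<And>e. e \<in> E \<Longrightarrow> w e > 0"
    and "all_ones_vec \<bullet> v = 0" "v \<noteq> 0" "laplacian E w *v v = c *\<^sub>R v"
  shows "c \<noteq> 0"
proof
  assume "c = 0"
  then have "v $ i = v $ j" for i j
    using laplacian_kernel_constant[of E w v] assms by simp
  then obtain t where const: "\<And>i. v $ i = t" by blast
  have "(\<Sum>i\<in>(UNIV :: 'n set). t) = 0"
    using assms(3) by (simp add: all_ones_vec_inner const)
  then have "v = 0" by (simp add: vec_eq_iff const)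
  with assms(4) show False by simp
qed

text \<open>The Rayleigh argument is applied to \<open>L\<close> and to \<open>- L\<close> on
  centered vectors. Knowing that \<open>a\<close> is a nonzero eigenvalue and \<open>b\<close> an
  eigenvalue lets them be compared later with the least nonzero and the largest one.\<close>

lemma laplacian_Rayleigh_bounds:
  fixes E :: "'n::finite set set"
  assumes n: "CARD('n) \<ge> 2" and conn: "connected_graph E" and w: "\<And>e. e \<in> E \<Longrightarrow> w e > 0"
  obtains a b where "a \<in> eigenvalues (laplacian E w)" "a \<noteq> 0"
    "b \<in> eigenvalues (laplacian E w)"
    "\<And>x. all_ones_vec \<bullet> x = 0 \<Longrightarrow> a * (x \<bullet> x) \<le> x \<bullet> (laplacian E w *v x)"
    "\<And>x. all_ones_vec \<bullet> x = 0 \<Longrightarrow> x \<bullet> (laplacian E w *v x) \<le> b * (x \<bullet> x)"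
proof -
  define T where "T = {x :: real^'n. all_ones_vec \<bullet> x = 0}"
  let ?L = "laplacian E w"
  have T: "subspace T" by (simp add: T_def subspace_hyperplane)
  have inv: "?L *v x \<in> T" for x
    by (simp add: T_def symmetric_mat_inner[OF symmetric_mat_laplacian] laplacian_all_ones_vec)
  obtain p q :: 'n where "p \<noteq> q"
    using n by (metis card_2_iff' card_le_Suc0_iff_eq finite UNIV_I not_less_eq_eq numeral_2_eq_2)
  \<comment> \<open>A nonzero centered vector, available because there are two distinct
    vertices.\<close>
  define z :: "real^'n" where "z = axis p 1 - axis q 1"
  have z: "z \<in> T" "z \<noteq> 0"
    using \<open>p \<noteq> q\<close> by (simp_all add: z_def T_def inner_simps inner_axis all_ones_vec_def axis_eq_axis)
  obtain v a where a: "v \<in> T" "v \<noteq> 0" "?L *v v = a *\<^sub>R v"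
      "\<And>x. x \<in> T \<Longrightarrow> a * (x \<bullet> x) \<le> x \<bullet> (?L *v x)"
    by (rule Rayleigh_minimum_on_invariant_subspace[of "(*v) ?L" T z])
      (use T inv z symmetric_mat_inner[OF symmetric_mat_laplacian] in
        \<open>auto intro: matrix_vector_mul_linear\<close>)
  \<comment> \<open>Here \<open>b\<close> is the minimum for \<open>- ?L\<close>, so
    \<open>- b\<close> is the maximum for \<open>?L\<close>.\<close>
  obtain u b where b: "u \<in> T" "u \<noteq> 0" "- (?L *v u) = b *\<^sub>R u"
      "\<And>x. x \<in> T \<Longrightarrow> b * (x \<bullet> x) \<le> x \<bullet> - (?L *v x)"
    by (rule Rayleigh_minimum_on_invariant_subspace[of "\<lambda>x. - (?L *v x)" T z])
      (use T inv z symmetric_mat_inner[OF symmetric_mat_laplacian] in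
        \<open>auto intro: linear_compose_neg matrix_vector_mul_linear subspace_neg\<close>)
  have "a \<noteq> 0"
    using centered_eigenvector_eigenvalue_nonzero[OF conn w _ a(2,3)] a(1) by (simp add: T_def)
  moreover have "?L *v u = (- b) *\<^sub>R u"
    using b(3) by (simp add: minus_equation_iff)
  moreover have "x \<bullet> (?L *v x) \<le> (- b) * (x \<bullet> x)" if "x \<in> T" for x
    using b(4)[OF that] by simp
  ultimately show thesis
    using a b(2) by (intro that[of a "- b"]) (auto simp: eigenvalues_def T_def)
qed

section \<open>Value of the semidefinite program\<close>

text \<open>Expanding the square of the sum; the induction step adds the pairs
  \<open>(i, Suc k)\<close>. It links the sum of squares in the constraint to the pair products in
  the optimal value.\<close>

lemma sum_pairs_less:
  fixes f :: "nat \<Rightarrow> real"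
  shows "2 * (\<Sum>(i, j) | i \<in> {1..k} \<and> j \<in> {1..k} \<and> i < j. f i * f j)
    = (\<Sum>i=1..k. f i)\<^sup>2 - (\<Sum>i=1..k. (f i)\<^sup>2)"
proof (induction k)
  case 0
  have "{(i, j). i \<in> {1..0} \<and> j \<in> {1..0} \<and> i < j} = ({} :: (nat \<times> nat) set)" by auto
  then show ?case by simp
next
  case (Suc k)
  let ?P = "\<lambda>k. {(i, j). i \<in> {1..k} \<and> j \<in> {1..k} \<and> i < (j::nat)}"
  have fin: "finite (?P k)" for k
    by (rule finite_subset[of _ "{1..k} \<times> {1..k}"]) auto
  have "?P (Suc k) = ?P k \<union> (\<lambda>i. (i, Suc k)) ` {1..k}" by auto
  then have "(\<Sum>(i, j)\<in>?P (Suc k). f i * f j) =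
      (\<Sum>(i, j)\<in>?P k. f i * f j) + (\<Sum>(i, j)\<in>(\<lambda>i. (i, Suc k)) ` {1..k}. f i * f j)"
    by (simp only:) (intro sum.union_disjoint, auto simp: fin[simplified])
  also have "(\<Sum>(i, j)\<in>(\<lambda>i. (i, Suc k)) ` {1..k}. f i * f j) = (\<Sum>i=1..k. f i) * f (Suc k)"
    by (subst sum.reindex) (auto simp: inj_on_def sum_distrib_right)
  finally show ?case
    using Suc.IH by (simp add: power2_eq_square algebra_simps)
qed

text \<open>Since \<open>L\<close> annihilates the all-ones vector, its trace against
  \<open>k Y - J\<close> is \<open>k\<close> times its trace against \<open>Y\<close>. A general
  symmetric \<open>L\<close> is allowed so that \<open>- L\<close> yields the upper bound.\<close>

lemma sdp_objective_ge:
  fixes L Y :: "real^'n::finite^'n"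
  assumes "symmetric_mat L" and L1: "L *v all_ones_vec = 0"
    and "\<And>x. all_ones_vec \<bullet> x = 0 \<Longrightarrow> c * (x \<bullet> x) \<le> x \<bullet> (L *v x)"
    and "k > 0" and "(\<Sum>i=1..k. m i) = CARD('n)" and "Y \<in> sdp_feasible k m"
  shows "c / real CARD('n) * ((\<Sum>i=1..k. real (m i))\<^sup>2 - (\<Sum>i=1..k. (real (m i))\<^sup>2)) / 2
    \<le> sdp_objective L Y"
proof -
  let ?n = "real CARD('n)" and ?s = "\<Sum>i=1..k. (real (m i))\<^sup>2"
  have sum: "(\<Sum>i=1..k. real (m i)) = ?n"
    using assms(5) by (metis of_nat_sum)
  have Y: "trace Y = ?n" "trace (all_ones_mat ** Y) = ?s" "psd (real k *\<^sub>R Y - all_ones_mat)"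
    using assms(6) by (auto simp: sdp_feasible_def)
  have [simp]: "trace (all_ones_mat :: real^'n^'n) = ?n"
    "trace (all_ones_mat ** (all_ones_mat :: real^'n^'n)) = ?n * ?n"
    by (simp_all add: trace_mult) (simp_all add: trace_def all_ones_mat_def)
  have [simp]: "trace (L ** all_ones_mat) = 0"
    by (simp add: all_ones_mat_eq_outer trace_mult_outer L1)
  have "c * (real k * ?n - ?n - (real k * ?s - ?n * ?n) / ?n) \<le> real k * trace (L ** Y)"
    using trace_mult_ge_of_centered_bound[OF assms(1-3) Y(3)] Y(1,2)
    by (simp add: trace_sub trace_scaleR matrix_sub_ldistrib matrix_mult_scaleR_right)
  \<comment> \<open>The contributions of the two traces of \<open>J\<close> cancel, which leaves a
    common factor \<open>k\<close>.\<close>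
  also have "c * (real k * ?n - ?n - (real k * ?s - ?n * ?n) / ?n)
      = real k * (c / ?n * (?n\<^sup>2 - ?s))"
    by (simp add: field_simps power2_eq_square)
  finally have "c / ?n * (?n\<^sup>2 - ?s) \<le> trace (L ** Y)"
    by (rule mult_left_le_imp_le) (use assms(4) in simp)
  then show ?thesis
    unfolding sum sdp_objective_def by simp
qed

text \<open>The witness has one free coefficient for each trace condition, and \<open>c\<close>
  enters only through \<open>L *v v\<close>, so the same construction serves the minimum and the
  maximum.\<close>

lemma sdp_objective_attained:
  fixes L :: "real^'n::finite^'n"
  assumes L1: "L *v all_ones_vec = 0" and "all_ones_vec \<bullet> v = 0" and "v \<noteq> 0"
    and Lv: "L *v v = c *\<^sub>R v"
    and "k > 0" and "(\<Sum>i=1..k. m i) = CARD('n)"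
  shows "\<exists>Y\<in>sdp_feasible k m. sdp_objective L Y =
    c / real CARD('n) * ((\<Sum>i=1..k. real (m i))\<^sup>2 - (\<Sum>i=1..k. (real (m i))\<^sup>2)) / 2"
proof -
  let ?n = "real CARD('n)" and ?s = "\<Sum>i=1..k. (real (m i))\<^sup>2" and ?u = "all_ones_vec :: real^'n"
  \<comment> \<open>The coefficient \<open>?s / ?n\<^sup>2\<close> in \<open>Y\<close> is fixed by
    the trace against \<open>J\<close>, and \<open>\<beta>\<close> then by the trace of
    \<open>Y\<close>; dividing by \<open>v \<bullet> v\<close> replaces normalising
    \<open>v\<close>.\<close>
  define \<beta> where "\<beta> = (?n - ?s / ?n) / (v \<bullet> v)"
  define Y where "Y = (?s / ?n\<^sup>2) *\<^sub>R outer ?u + \<beta> *\<^sub>R outer v"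
  have v0: "v \<bullet> v > 0" using assms(3) by simp
  have sum: "(\<Sum>i=1..k. real (m i)) = ?n"
    using assms(6) by (metis of_nat_sum)
  \<comment> \<open>Cauchy-Schwarz against the constant 1; it makes the all-ones part of
    \<open>k Y - J\<close> nonnegative.\<close>
  have "?n\<^sup>2 \<le> real k * ?s"
    using Cauchy_Schwarz_ineq_sum[of "\<lambda>_. 1" "\<lambda>i. real (m i)" "{1..k}"] sum by simp
  then have ineq1: "0 \<le> real k * (?s / ?n\<^sup>2) - 1"
    by (simp add: field_simps)
  have "?s \<le> ?n\<^sup>2"
  proof -
    have "0 \<le> 2 * (\<Sum>(i, j) | i \<in> {1..k} \<and> j \<in> {1..k} \<and> i < j. real (m i) * real (m j))"
      by (intro mult_nonneg_nonneg sum_nonneg) auto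
    then show ?thesis unfolding sum_pairs_less sum by simp
  qed
  then have "0 \<le> \<beta>"
    using v0 by (simp add: \<beta>_def field_simps power2_eq_square)
  have tr: "trace (M ** Y) = ?s / ?n\<^sup>2 * (?u \<bullet> (M *v ?u)) + \<beta> * (v \<bullet> (M *v v))" for M
    by (simp add: Y_def matrix_add_ldistrib trace_add matrix_mult_scaleR_right trace_scaleR
        trace_mult_outer)
  have "symmetric_mat Y"
    unfolding Y_def by (intro symmetric_mat_add symmetric_mat_scaleR symmetric_mat_outer)
  moreover have "trace Y = ?n"
    using tr[of "mat 1"] v0 by (simp add: all_ones_vec_inner_self \<beta>_def field_simps power2_eq_square)
  moreover have "trace (all_ones_mat ** Y) = ?s"
    unfolding tr using assms(2)
    by (simp add: all_ones_mat_eq_outer outer_mult_vec all_ones_vec_inner_self power2_eq_square)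
  moreover have "psd (real k *\<^sub>R Y - all_ones_mat)"
    unfolding psd_def
  proof (intro conjI allI)
    show "symmetric_mat (real k *\<^sub>R Y - all_ones_mat)"
      unfolding all_ones_mat_eq_outer using calculation(1)
      by (intro symmetric_mat_diff symmetric_mat_scaleR symmetric_mat_outer)
    fix x
    have "x \<bullet> ((real k *\<^sub>R Y - all_ones_mat) *v x)
        = (real k * (?s / ?n\<^sup>2) - 1) * (?u \<bullet> x)\<^sup>2 + real k * \<beta> * (v \<bullet> x)\<^sup>2"
      by (simp add: Y_def matrix_vector_mult_diff_rdistrib matrix_vector_mult_add_rdistrib
          scaleR_matrix_vector_assoc[symmetric] all_ones_mat_eq_outer outer_mult_vec inner_simps
          inner_commute power2_eq_square algebra_simps del: times_divide_eq_right)
    also have "\<dots> \<ge> 0"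
      using ineq1 \<open>0 \<le> \<beta>\<close> by (intro add_nonneg_nonneg mult_nonneg_nonneg) auto
    finally show "0 \<le> x \<bullet> ((real k *\<^sub>R Y - all_ones_mat) *v x)" .
  qed
  ultimately have "Y \<in> sdp_feasible k m"
    by (simp add: sdp_feasible_def)
  moreover have "sdp_objective L Y = c / ?n * (?n\<^sup>2 - ?s) / 2"
    using v0 by (simp add: sdp_objective_def tr L1 Lv \<beta>_def field_simps power2_eq_square)
  ultimately show ?thesis unfolding sum by blast
qed

section \<open>Vertex partitions as feasible matrices\<close>

text \<open>A block of size \<open>m (Suc k)\<close> is split off and the rest handled by induction,
  hence the arbitrary finite set \<open>A\<close>. This keeps \<open>Min\<close> and
  \<open>Max\<close> from being taken over the empty set.\<close>

lemma partition_exists: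
  fixes m :: "nat \<Rightarrow> nat"
  assumes "finite A" and "(\<Sum>i=1..k. m i) = card A"
  shows "\<exists>S. disjoint_family_on S {1..k} \<and> (\<Union>i\<in>{1..k}. S i) = A \<and> (\<forall>i\<in>{1..k}. card (S i) = m i)"
  using assms
proof (induction k arbitrary: A)
  case 0
  then show ?case by (auto simp: disjoint_family_on_def)
next
  case (Suc k)
  obtain B where B: "B \<subseteq> A" "card B = m (Suc k)"
    using Suc.prems obtain_subset_with_card_n[of "m (Suc k)" A] by auto
  then have "card (A - B) = (\<Sum>i=1..k. m i)"
    using Suc.prems by (simp add: card_Diff_subset finite_subset)
  then obtain S where S: "disjoint_family_on S {1..k}" "(\<Union>i\<in>{1..k}. S i) = A - B"
      "\<forall>i\<in>{1..k}. card (S i) = m i"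
    using Suc.IH[of "A - B"] Suc.prems(1) by auto
  have eq: "{1..Suc k} = insert (Suc k) {1..k}" by auto
  have sub: "S i \<inter> B = {}" if "i \<in> {1..k}" for i using S(2) that by blast
  have "disjoint_family_on (S(Suc k := B)) {1..Suc k}"
    using S(1) sub unfolding eq disjoint_family_on_def by (fastforce simp: fun_upd_def)
  moreover have "(\<Union>i\<in>{1..Suc k}. (S(Suc k := B)) i) = A"
  proof -
    have "(\<Union>i\<in>{1..k}. (S(Suc k := B)) i) = (\<Union>i\<in>{1..k}. S i)" by (intro SUP_cong) auto
    then show ?thesis
      unfolding eq UN_insert fun_upd_same S(2) using B(1) by blast
  qed
  moreover have "\<forall>i\<in>{1..Suc k}. card ((S(Suc k := B)) i) = m i"
    unfolding eq using S(3) B(2) by auto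
  ultimately show ?case by blast
qed

text \<open>Ordered pairs are grouped by the edge they span; as every edge has two distinct ends,
  each group has exactly two pairs. The subset \<open>F\<close> will be the cut edges.\<close>

lemma sum_pairs_adjacency:
  assumes "simple_graph (E :: 'n::finite set set)" and "F \<subseteq> E"
  shows "(\<Sum>a\<in>UNIV. \<Sum>b\<in>UNIV. if {a, b} \<in> F then w {a, b} else 0) = (2::real) * (\<Sum>e\<in>F. w e)"
proof -
  let ?P = "{(a, b). {a, b} \<in> F}"
  have "(\<Sum>a\<in>UNIV. \<Sum>b\<in>UNIV. if {a, b} \<in> F then w {a, b} else 0)
      = (\<Sum>(a, b)\<in>UNIV. if {a, b} \<in> F then w {a, b} else 0)"
    by (simp add: sum.cartesian_product)
  also have "\<dots> = (\<Sum>(a, b)\<in>?P. w {a, b})"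
    by (intro sum.mono_neutral_cong_right) (auto split: if_splits)
  also have "\<dots> = (\<Sum>e\<in>F. \<Sum>(a, b)\<in>{p \<in> ?P. (\<lambda>(a, b). {a, b}) p = e}. w {a, b})"
    by (intro sum.group[symmetric]) auto
  also have "\<dots> = (\<Sum>e\<in>F. 2 * w e)"
  proof (rule sum.cong[OF refl])
    fix e assume e: "e \<in> F"
    then have "card e = 2" using assms by (auto simp: simple_graph_def)
    then obtain x y where xy: "e = {x, y}" "x \<noteq> y" by (auto simp: card_2_iff)
    have "{p \<in> ?P. (\<lambda>(a, b). {a, b}) p = e} = {(x, y), (y, x)}"
      using e xy by (auto simp: doubleton_eq_iff insert_commute)
    then show "(\<Sum>(a, b)\<in>{p \<in> ?P. (\<lambda>(a, b). {a, b}) p = e}. w {a, b}) = 2 * w e"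
      using xy by (simp add: insert_commute[of y x])
  qed
  finally show ?thesis by (simp add: sum_distrib_left)
qed

text \<open>The block matrix is the sum of the outer products of the block indicator vectors. This
  turns the trace against \<open>J\<close> into squared block sizes and semidefiniteness into
  Cauchy-Schwarz over the \<open>k\<close> blocks.\<close>

lemma partition_sdp_feasible:
  fixes E :: "'n::finite set set"
  assumes graph: "simple_graph E" and S: "S \<in> vertex_partitions k m"
  shows "\<exists>Y\<in>sdp_feasible k m. sdp_objective (laplacian E w) Y = cut_weight E w k S"
proof -
  have disj: "i = j" if "i \<in> {1..k}" "j \<in> {1..k}" "u \<in> S i" "u \<in> S j" for i j u
    using S that unfolding vertex_partitions_def disjoint_family_on_def by blast
  have "\<exists>i\<in>{1..k}. u \<in> S i" for u
    using S by (auto simp: vertex_partitions_def)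
  \<comment> \<open>\<open>b u\<close> is the index of the block containing
    \<open>u\<close>.\<close>
  then obtain b where b: "\<And>u. b u \<in> {1..k}" "\<And>u. u \<in> S (b u)" by metis
  have S_iff: "u \<in> S i \<longleftrightarrow> b u = i" if "i \<in> {1..k}" for u i
    using that b disj by blast
  define x :: "nat \<Rightarrow> real^'n" where "x i = (\<chi> u. if b u = i then 1 else 0)" for i
  define Y :: "real^'n^'n" where "Y = (\<chi> u v. if b u = b v then 1 else 0)"
  have Y_sum: "Y = (\<Sum>i=1..k. outer (x i))"
  proof -
    have "(\<Sum>i=1..k. outer (x i) $ u $ v) = Y $ u $ v" for u v
    proof -
      have "(\<Sum>i=1..k. outer (x i) $ u $ v) = (\<Sum>i=1..k. if i = b u then Y $ u $ v else 0)"
        by (intro sum.cong) (auto simp: outer_def x_def Y_def)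
      then show ?thesis using b(1)[of u] by simp
    qed
    then show ?thesis by (simp add: vec_eq_iff)
  qed
  have card_x: "all_ones_vec \<bullet> x i = real (m i)" if "i \<in> {1..k}" for i
  proof -
    have "S i = {u. b u = i}" using S_iff[OF that] by blast
    moreover have "card (S i) = m i"
      using S that unfolding vertex_partitions_def by blast
    ultimately have "card {u. b u = i} = m i" by simp
    then show ?thesis by (simp add: all_ones_vec_inner x_def sum.If_cases)
  qed
  have ones: "all_ones_vec = (\<Sum>i=1..k. x i)"
    using b(1) by (simp add: vec_eq_iff all_ones_vec_def x_def)
  have "symmetric_mat Y"
    by (auto simp: symmetric_mat_def Y_def transpose_def vec_eq_iff)
  moreover have "trace Y = real CARD('n)"
    by (simp add: trace_def Y_def)
  moreover have "trace (all_ones_mat ** Y) = (\<Sum>i=1..k. (real (m i))\<^sup>2)"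
  proof -
    have "trace (all_ones_mat ** Y) = all_ones_vec \<bullet> (Y *v all_ones_vec)"
      by (subst trace_mul_sym) (simp add: all_ones_mat_eq_outer trace_mult_outer)
    also have "\<dots> = (\<Sum>i=1..k. (all_ones_vec \<bullet> x i)\<^sup>2)"
      by (simp add: Y_sum matrix_vector_mult_sum_rdistrib outer_mult_vec inner_sum_right
          inner_commute power2_eq_square)
    finally show ?thesis using card_x by simp
  qed
  moreover have "psd (real k *\<^sub>R Y - all_ones_mat)"
    unfolding psd_def
  proof (intro conjI allI)
    show "symmetric_mat (real k *\<^sub>R Y - all_ones_mat)"
      unfolding all_ones_mat_eq_outer using \<open>symmetric_mat Y\<close>
      by (intro symmetric_mat_diff symmetric_mat_scaleR symmetric_mat_outer)
    fix z
    have "z \<bullet> ((real k *\<^sub>R Y - all_ones_mat) *v z)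
        = real k * (\<Sum>i=1..k. (x i \<bullet> z)\<^sup>2) - (all_ones_vec \<bullet> z)\<^sup>2"
      by (simp add: Y_sum matrix_vector_mult_diff_rdistrib matrix_vector_mult_sum_rdistrib
          scaleR_matrix_vector_assoc[symmetric] all_ones_mat_eq_outer outer_mult_vec inner_simps
          inner_sum_right inner_commute power2_eq_square)
    also have "all_ones_vec \<bullet> z = (\<Sum>i=1..k. x i \<bullet> z)"
      by (simp add: ones inner_sum_left)
    also have "real k * (\<Sum>i=1..k. (x i \<bullet> z)\<^sup>2) - (\<Sum>i=1..k. x i \<bullet> z)\<^sup>2 \<ge> 0"
      using Cauchy_Schwarz_ineq_sum[of "\<lambda>_. 1" "\<lambda>i. x i \<bullet> z" "{1..k}"] by simp
    finally show "0 \<le> z \<bullet> ((real k *\<^sub>R Y - all_ones_mat) *v z)" .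
  qed
  ultimately have "Y \<in> sdp_feasible k m"
    by (simp add: sdp_feasible_def)
  moreover have "sdp_objective (laplacian E w) Y = cut_weight E w k S"
  proof -
    have cut: "{u, v} \<in> cut_edges E k S \<longleftrightarrow> {u, v} \<in> E \<and> b u \<noteq> b v" for u v
    proof
      assume "{u, v} \<in> cut_edges E k S"
      then show "{u, v} \<in> E \<and> b u \<noteq> b v"
        by (auto simp: cut_edges_def S_iff doubleton_eq_iff)
    next
      assume "{u, v} \<in> E \<and> b u \<noteq> b v"
      then show "{u, v} \<in> cut_edges E k S"
        using b unfolding cut_edges_def by blast
    qed
    \<comment> \<open>Column \<open>u\<close> of \<open>Y\<close> indicates the block of
      \<open>u\<close>, so in the difference form of the Laplacian
      \<open>Y $ u $ u - Y $ v $ u\<close> is 1 for \<open>v\<close> in another block and 0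
      otherwise.\<close>
    have "trace (laplacian E w ** Y) = (\<Sum>u\<in>UNIV. (laplacian E w *v (\<chi> v. Y $ v $ u)) $ u)"
      by (simp add: trace_mult matrix_vector_mult_def)
    also have "\<dots> = (\<Sum>u\<in>UNIV. \<Sum>v\<in>UNIV. if {u, v} \<in> cut_edges E k S then w {u, v} else 0)"
      unfolding laplacian_mult_vec_nth
      by (intro sum.cong) (auto simp: Y_def adjacency_def cut)
    also have "\<dots> = 2 * cut_weight E w k S"
      unfolding cut_weight_def
      by (rule sum_pairs_adjacency[OF graph]) (auto simp: cut_edges_def)
    finally show ?thesis by (simp add: sdp_objective_def)
  qed
  ultimately show ?thesis by blast
qed

section \<open>Matching the Rayleigh bounds with the ordered eigenvalues\<close>

theorem theorem5:
  fixes E :: "'n::finite set set" and w :: "'n set \<Rightarrow> real"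
    and lam :: "nat \<Rightarrow> real" and d k :: nat and m :: "nat \<Rightarrow> nat"
  assumes "CARD('n) \<ge> 2"
    and "simple_graph E" and "connected_graph E"
    and "\<And>e. e \<in> E \<Longrightarrow> w e > 0"
    and "eigenvalues (laplacian E w) = lam ` {0..d}"
    and "strict_mono_on {0..d} lam" and "lam 0 = 0"
    and "k > 0" and "\<And>i. i \<in> {1..k} \<Longrightarrow> m i > 0"
    and "(\<Sum>i=1..k. m i) = CARD('n)"
  defines "L \<equiv> laplacian E w"
    and "pair_sum \<equiv> (\<Sum>(i, j) | i \<in> {1..k} \<and> j \<in> {1..k} \<and> i < j. real (m i) * real (m j))"
  shows "optimal_value_min (sdp_objective L) (sdp_feasible k m)
           (lam 1 / real CARD('n) * pair_sum)
       \<and> lam 1 / real CARD('n) * pair_sum \<le> min_graph_partition E w k m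
       \<and> optimal_value_max (sdp_objective L) (sdp_feasible k m)
           (lam d / real CARD('n) * pair_sum)
       \<and> max_graph_partition E w k m \<le> lam d / real CARD('n) * pair_sum"
proof -
  let ?n = "real CARD('n)" and ?u = "all_ones_vec :: real^'n"
  let ?cuts = "cut_weight E w k ` (vertex_partitions k m :: (nat \<Rightarrow> 'n set) set)"
  have pair: "c / ?n * ((\<Sum>i=1..k. real (m i))\<^sup>2 - (\<Sum>i=1..k. (real (m i))\<^sup>2)) / 2
      = c / ?n * pair_sum" for c
    unfolding sum_pairs_less[symmetric] pair_sum_def by simp
  have sym: "symmetric_mat L" and L1: "L *v ?u = 0"
    by (simp_all add: L_def symmetric_mat_laplacian laplacian_all_ones_vec)
  have mono: "lam i \<le> lam j" if "i \<le> j" "j \<le> d" for i j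
    using assms(6) that by (cases "i = j") (auto simp: strict_mono_on_def intro!: less_imp_le)
  obtain a b where ab: "a \<in> eigenvalues L" "a \<noteq> 0" "b \<in> eigenvalues L"
      "\<And>x. ?u \<bullet> x = 0 \<Longrightarrow> a * (x \<bullet> x) \<le> x \<bullet> (L *v x)"
      "\<And>x. ?u \<bullet> x = 0 \<Longrightarrow> x \<bullet> (L *v x) \<le> b * (x \<bullet> x)"
    using laplacian_Rayleigh_bounds[where w = w, OF assms(1,3,4)] unfolding L_def by blast
  obtain i where i: "a = lam i" "i \<le> d"
    using ab(1) assms(5) by (auto simp: L_def)
  \<comment> \<open>As \<open>a\<close> is nonzero, its index is not 0; this also shows that
    \<open>lam 1\<close> is one of the listed eigenvalues.\<close>
  with ab(2) assms(7) have "1 \<le> i" by (cases i) auto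
  then have "1 \<le> d" "lam 1 \<le> a" using i mono by auto
  have "b \<le> lam d"
    using ab(3) assms(5) mono by (auto simp: L_def)
  have lower: "lam 1 * (x \<bullet> x) \<le> x \<bullet> (L *v x)" if "?u \<bullet> x = 0" for x
    using ab(4)[OF that] mult_right_mono[OF \<open>lam 1 \<le> a\<close>, of "x \<bullet> x"] by simp
  \<comment> \<open>The maximum is treated as a minimum for \<open>- L\<close>, with constant
    \<open>- lam d\<close>.\<close>
  have upper: "- lam d * (x \<bullet> x) \<le> x \<bullet> ((- L) *v x)" if "?u \<bullet> x = 0" for x
    using ab(5)[OF that] mult_right_mono[OF \<open>b \<le> lam d\<close>, of "x \<bullet> x"]
    by (simp add: matrix_vector_mult_minus_left)
  have ge: "lam 1 / ?n * pair_sum \<le> sdp_objective L Y" if "Y \<in> sdp_feasible k m" for Y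
    using sdp_objective_ge[OF sym L1 lower assms(8,10) that] unfolding pair .
  have le: "sdp_objective L Y \<le> lam d / ?n * pair_sum" if "Y \<in> sdp_feasible k m" for Y
  proof -
    have "symmetric_mat (- L)" "(- L) *v ?u = 0"
      using symmetric_mat_scaleR[OF sym, of "-1"] L1 by (simp_all add: matrix_vector_mult_minus_left)
    from sdp_objective_ge[OF this upper assms(8,10) that]
    have "- lam d / ?n * pair_sum \<le> sdp_objective (- L) Y" unfolding pair by simp
    moreover have "sdp_objective (- L) Y = - sdp_objective L Y"
      by (simp add: sdp_objective_def trace_mult sum_negf)
    ultimately show ?thesis by simp
  qed
  have attained: "\<exists>Y\<in>sdp_feasible k m. sdp_objective L Y = lam j / ?n * pair_sum"
    if "1 \<le> j" "j \<le> d" for j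
  proof -
    have "lam j \<noteq> 0"
      using assms(6,7) that by (metis atLeastAtMost_iff le0 le_trans less_numeral_extra(1)
          less_le_trans order_less_irrefl strict_mono_onD)
    have "lam j \<in> eigenvalues L" using assms(5) that by (auto simp: L_def)
    then obtain v where v: "v \<noteq> 0" "L *v v = lam j *\<^sub>R v" by (auto simp: eigenvalues_def)
    \<comment> \<open>Eigenvectors of a symmetric matrix for the distinct eigenvalues
      \<open>lam j\<close> and 0 are orthogonal.\<close>
    have "lam j * (?u \<bullet> v) = ?u \<bullet> (L *v v)" by (simp add: v(2))
    also have "\<dots> = 0" by (simp add: symmetric_mat_inner[OF sym] L1)
    finally have "?u \<bullet> v = 0" using \<open>lam j \<noteq> 0\<close> by simp
    from sdp_objective_attained[OF L1 this v assms(8,10)] show ?thesis unfolding pair .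
  qed
  \<comment> \<open>\<open>vertex_partitions k m\<close> is infinite, its members being arbitrary
    outside \<open>{1..k}\<close>; the cut weights are finitely many, as sums of \<open>w\<close>
    over subsets of \<open>E\<close>.\<close>
  have "?cuts \<subseteq> sum w ` Pow E"
    by (auto simp: cut_weight_def cut_edges_def)
  then have fin: "finite ?cuts" by (rule finite_subset) simp
  have "\<exists>S. S \<in> (vertex_partitions k m :: (nat \<Rightarrow> 'n set) set)"
    using partition_exists[of "UNIV :: 'n set" m k] assms(10) by (auto simp: vertex_partitions_def)
  then have ne: "?cuts \<noteq> {}" by blast
  have cut: "lam 1 / ?n * pair_sum \<le> c \<and> c \<le> lam d / ?n * pair_sum" if "c \<in> ?cuts" for c
  proof -
    obtain S where "S \<in> vertex_partitions k m" "c = cut_weight E w k S" using \<open>c \<in> ?cuts\<close> by blast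
    then obtain Y where "Y \<in> sdp_feasible k m" "sdp_objective L Y = c"
      using partition_sdp_feasible[OF assms(2), of S k m w] unfolding L_def by metis
    then show ?thesis using ge le by blast
  qed
  show ?thesis
    unfolding optimal_value_min_def optimal_value_max_def min_graph_partition_def
      max_graph_partition_def
    using ge le attained[of 1] attained[of d] \<open>1 \<le> d\<close> Min_in[OF fin ne] Max_in[OF fin ne] cut
    by blast
qed

end
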